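(* Let $X$ be a metric space whose $1$-growth function $\gamma(r)=\gamma^1(r)$ satisfies $$\lim_{r\to\infty}\frac{\gamma(r)}{r^{k+1}}=0\quad\text{for some } k\in\mathbb N.$$ Then $\operatorname{asdim} X\le k$.
   Context: Let $X$ be a metric space and $t>0$. A $(t,t)$-net of $X$ is a subset $N\subset X$ such that for any $x\in X$ there is $p\in N$ with $d(x,p)\le t$, and $d(p_1,p_2)\ge t$ for any two distinct $p_1,p_2\in N$. The $t$-growth function of $X$ is $$\gamma^t(r)=\sup\{|B_v(r)\cap N|: v\in X,\ N\text{ a }(t,t)\text{-net of }X\},$$ where $B_v(r)$ is the ball of radius $r$ centered at $v$. The asymptotic dimension $\operatorname{asdim} X$ of a metric space $X$ is defined as follows: $\operatorname{asdim} X\le n$ if and only if for every $m>0$ there exist $D(m)>0$ and a covering $\mathcal U$ of $X$ by sets of diameter $\le D(m)$ such that any ball of radius $m$ in $X$ intersects at most $n+1$ elements of $\mathcal U$. *)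

theory Defs
  imports "HOL-Analysis.Analysis"
begin

text \<open>Cardinality in \<open>enat\<close>, so that an infinite set has cardinality \<open>\<infinity>\<close>
  (\<open>card\<close> would return 0).\<close>

definition ecard :: "'a set \<Rightarrow> enat" where
  "ecard A = (if finite A then enat (card A) else \<infinity>)"

context Metric_space
begin

definition net :: "real \<Rightarrow> 'a set \<Rightarrow> bool" where
  "net t N \<longleftrightarrow> N \<subseteq> M
     \<and> (\<forall>x\<in>M. \<exists>p\<in>N. d x p \<le> t)
     \<and> (\<forall>p\<in>N. \<forall>q\<in>N. p \<noteq> q \<longrightarrow> t \<le> d p q)"

text \<open>Balls are read as open; closed balls give the same asymptotics of the growth function
  and the same asymptotic dimension.\<close>

definition growth :: "real \<Rightarrow> real \<Rightarrow> enat" where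
  "growth t r = Sup {ecard (mball v r \<inter> N) | v N. v \<in> M \<and> net t N}"

text \<open>The bound \<open>D\<close> on the diameter is written out pointwise, because the \<open>diameter\<close>
  of the library is a real supremum and unspecified for unbounded sets.\<close>

definition asdim_le :: "nat \<Rightarrow> bool" where
  "asdim_le n \<longleftrightarrow>
     (\<forall>m>0. \<exists>D>0. \<exists>\<U>. (\<forall>U\<in>\<U>. U \<subseteq> M) \<and> \<Union>\<U> = M
        \<and> (\<forall>U\<in>\<U>. \<forall>x\<in>U. \<forall>y\<in>U. d x y \<le> D)
        \<and> (\<forall>v\<in>M. ecard {U\<in>\<U>. mball v m \<inter> U \<noteq> {}} \<le> enat (n + 1)))"

definition asdim :: enat where
  "asdim = Inf {enat n | n. asdim_le n}"

lemma asdim_le_mono: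
  assumes "asdim_le m" "m \<le> n"
  shows "asdim_le n"
proof -
  have "x \<le> enat (m + 1) \<Longrightarrow> x \<le> enat (n + 1)" for x
    using assms(2) by (cases x) simp_all
  then show ?thesis
    using assms(1) unfolding asdim_le_def Ball_def
    by (elim all_forward imp_forward ex_forward conj_forward) assumption+
qed

lemma asdim_le_iff: "asdim \<le> enat n \<longleftrightarrow> asdim_le n"
proof
  assume le: "asdim \<le> enat n"
  show "asdim_le n"
  proof (rule ccontr)
    assume "\<not> asdim_le n"
    then have "enat (Suc n) \<le> enat j" if "asdim_le j" for j
      using asdim_le_mono[OF that, of n] by fastforce
    then have "enat (Suc n) \<le> asdim"
      unfolding asdim_def by (intro Inf_greatest) auto
    also note le
    finally show False by simp
  qed
next
  assume "asdim_le n"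
  then show "asdim \<le> enat n"
    unfolding asdim_def by (intro Inf_lower) auto
qed

end

end

theory Submission
  imports Defs "HOL-Complex_Analysis.Great_Picard"
begin

text \<open>It suffices to colour a \<open>1\<close>-net with \<open>k + 1\<close> colours so that the \<open>m\<close>-chain components of every
  colour class are uniformly bounded. In a finite set \<open>X\<close>, let \<open>Z\<close> be of minimal cardinality among the
  subsets whose complement has bounded \<open>m\<close>-chain components. Replacing the part of \<open>Z\<close> in a ball by
  any of \<open>n\<close> disjoint shells of width \<open>m\<close> around it keeps this property, so by minimality balls in \<open>Z\<close>
  have at most \<open>1 / n\<close> times as many points as slightly larger balls in \<open>X\<close>. Iterating \<open>k + 1\<close> times
  with \<open>n\<close> so large that balls of radius \<open>(k + 1) n m\<close> have fewer than \<open>n\<^sup>k\<^sup>+\<^sup>1\<close> points leaves the empty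
  set, and the successive differences are the colour classes. The bound does not depend on \<open>X\<close>, so
  compactness gives a colouring of the whole net.\<close>

context Metric_space
begin

section \<open>Chains and colourings of finite sets\<close>

text \<open>Both endpoints are kept in \<open>A\<close>, so the transitive closure describes chains
  that never leave \<open>A\<close>. For \<open>m\<close> \<ge> 0 and \<open>A\<close> inside
  \<open>M\<close> it is an equivalence relation on \<open>A\<close>, with the
  \<open>m\<close>-chain components as its classes.\<close>

definition link :: "real \<Rightarrow> 'a set \<Rightarrow> ('a \<times> 'a) set" where
  "link m A = {(x, y). x \<in> A \<and> y \<in> A \<and> d x y \<le> m}"

definition components_bounded :: "real \<Rightarrow> real \<Rightarrow> 'a set \<Rightarrow> bool" where
  "components_bounded m D A \<longleftrightarrow> (\<forall>(x, y)\<in>(link m A)\<^sup>+. d x y \<le> D)"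

definition good_colouring :: "real \<Rightarrow> real \<Rightarrow> nat \<Rightarrow> 'a set \<Rightarrow> ('a \<Rightarrow> nat) \<Rightarrow> bool" where
  "good_colouring m D n A c \<longleftrightarrow>
     c ` A \<subseteq> {..<n} \<and> (\<forall>i. components_bounded m D {x\<in>A. c x = i})"

lemma link_trancl_in:
  assumes "(x, y) \<in> (link m A)\<^sup>+"
  shows "x \<in> A" "y \<in> A"
  using assms by (induction rule: trancl_induct) (auto simp: link_def)

lemma link_mono: "A \<subseteq> B \<Longrightarrow> link m A \<subseteq> link m B"
  by (auto simp: link_def)

lemma sym_link: "sym (link m A)"
  by (auto simp: link_def sym_def commute)

lemma components_bounded_subset:
  "components_bounded m D B \<Longrightarrow> A \<subseteq> B \<Longrightarrow> components_bounded m D A"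
  unfolding components_bounded_def using trancl_mono[OF _ link_mono] by blast

text \<open>A step of length at most \<open>m\<close> cannot cross the shell, so a chain in \<open>X - Z'\<close> stays in the
  ball or is a chain in \<open>X - Z\<close> outside it.\<close>

lemma components_bounded_replace_ball:
  assumes X: "X \<subseteq> M" and v: "v \<in> M"
    and Z: "components_bounded m D (X - Z)"
    and D: "2 * s \<le> D"
    and Z': "Z' = {z\<in>Z. s < d v z} \<union> {x\<in>X. s < d v x \<and> d v x \<le> s + m}"
  shows "components_bounded m D (X - Z')"
proof -
  have link: "(d v x \<le> s \<and> d v y \<le> s) \<or>
      (s + m < d v x \<and> s + m < d v y \<and> (x, y) \<in> link m (X - Z))"
    if "(x, y) \<in> link m (X - Z')" for x y
  proof -
    have xy: "x \<in> X - Z'" "y \<in> X - Z'" "d x y \<le> m"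
      using that by (auto simp: link_def)
    then have "x \<in> M" "y \<in> M"
      using X by auto
    then have tri: "d v y \<le> d v x + d x y" "d v x \<le> d v y + d x y" "0 \<le> d x y"
      using triangle[of v x y] triangle[of v y x] v commute[of x y] by auto
    have "d v x \<le> s \<or> s + m < d v x" "d v y \<le> s \<or> s + m < d v y"
      using xy Z' by auto
    then consider "d v x \<le> s" "d v y \<le> s" | "s + m < d v x" "s + m < d v y"
      using xy(3) tri by linarith
    then show ?thesis
    proof cases
      case 2
      then have "s < d v x" "s < d v y"
        using tri xy(3) by linarith+
      then have "(x, y) \<in> link m (X - Z)"
        using xy Z' by (auto simp: link_def)
      with 2 show ?thesis by blast
    qed blast
  qed
  have "(d v x \<le> s \<and> d v y \<le> s) \<or>
      (s + m < d v x \<and> s + m < d v y \<and> (x, y) \<in> (link m (X - Z))\<^sup>+)"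
    if "(x, y) \<in> (link m (X - Z'))\<^sup>+" for x y
    using that
  proof (induction rule: trancl_induct)
    case (base y)
    from link[OF this] show ?case by blast
  next
    case (step y z)
    \<comment> \<open>The mere existence of a step forces \<open>m\<close> \<ge> 0. Hence
      \<open>d v y\<close> \<le> \<open>s\<close> and \<open>s + m < d v y\<close> exclude each
      other, and a chain cannot change sides at \<open>y\<close>.\<close>
    have "d y z \<le> m"
      using step.hyps(2) by (simp add: link_def)
    then have "0 \<le> m"
      using nonneg order_trans by blast
    then show ?case
      using link[OF step.hyps(2)] step.IH by (force intro: trancl_into_trancl)
  qed
  moreover have "d x y \<le> D" if "d v x \<le> s" "d v y \<le> s" "x \<in> X" "y \<in> X" for x y
    using that X v D triangle[of x v y] commute[of x v] by (auto simp: subset_iff)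
  moreover have "d x y \<le> D" if "(x, y) \<in> (link m (X - Z))\<^sup>+" for x y
    using that Z unfolding components_bounded_def by auto
  ultimately show ?thesis
    unfolding components_bounded_def using link_trancl_in by blast
qed

text \<open>Minimality is global, so one \<open>Z\<close> serves all centres \<open>v\<close> at
  once. The bound on \<open>D\<close> covers the diameter of the largest ball that an exchange can
  cut out.\<close>

lemma exists_thin_separator:
  assumes "finite X" and X: "X \<subseteq> M" and "0 \<le> m" and D: "2 * (r + real n * m) \<le> D"
  obtains Z where "Z \<subseteq> X" "components_bounded m D (X - Z)"
    "\<And>v. v \<in> M \<Longrightarrow> n * card (Z \<inter> mcball v r) \<le> card (X \<inter> mcball v (r + real n * m))"
proof -
  define P where "P Z \<longleftrightarrow> Z \<subseteq> X \<and> components_bounded m D (X - Z)" for Z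
  \<comment> \<open>The complement of \<open>X\<close> in itself is empty, so there is a candidate
    to minimise over.\<close>
  have "P X"
    unfolding P_def components_bounded_def using link_trancl_in by fastforce
  then obtain Z where Z: "P Z" and min: "\<And>Z'. P Z' \<Longrightarrow> card Z \<le> card Z'"
    using ex_has_least_nat[of P X card] by blast
  have "n * card (Z \<inter> mcball v r) \<le> card (X \<inter> mcball v (r + real n * m))" if v: "v \<in> M" for v
  proof -
    \<comment> \<open>Half-open shells: consecutive ones share no point, and the first
      \<open>n\<close> fit into the ball of radius \<open>r + real n * m\<close>.\<close>
    define S where "S j = {x\<in>X. r + real j * m < d v x \<and> d v x \<le> r + real j * m + m}" for j
    have fin: "finite Z" "\<And>j. finite (S j)"
      using Z \<open>finite X\<close> by (auto simp: P_def S_def intro: finite_subset)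
    have le: "card (Z \<inter> mcball v r) \<le> card (S j)" if "j < n" for j
    proof -
      define s where "s = r + real j * m"
      define In where "In = {z\<in>Z. d v z \<le> s}"
      define Out where "Out = {z\<in>Z. s < d v z}"
      have "real j * m \<le> real n * m"
        using that \<open>0 \<le> m\<close> by (intro mult_right_mono) auto
      then have "P (Out \<union> S j)"
        using components_bounded_replace_ball[OF X v, of m D Z s "Out \<union> S j"] Z D
        by (auto simp: P_def S_def Out_def s_def)
      \<comment> \<open>Exchanging \<open>In\<close> for \<open>S j\<close> cannot lower the
        cardinality. Cancelling \<open>Out\<close> on both sides leaves \<open>card In\<close> \<le>
        \<open>card (S j)\<close>.\<close>
      then have "card Z \<le> card Out + card (S j)"
        using min card_Un_le le_trans by blast
      moreover have "card Z = card In + card Out"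
        using fin by (subst card_Un_disjoint[symmetric])
          (auto simp: In_def Out_def intro: arg_cong[where f = card])
      moreover have "card (Z \<inter> mcball v r) \<le> card In"
        using fin \<open>0 \<le> m\<close> by (intro card_mono) (auto simp: In_def s_def intro: add_increasing2)
      ultimately show ?thesis by linarith
    qed
    have disj: "S i \<inter> S j = {}" if "i < j" for i j
    proof -
      have "real (Suc i) * m \<le> real j * m"
        using that \<open>0 \<le> m\<close> by (intro mult_right_mono) auto
      then show ?thesis
        by (auto simp: S_def algebra_simps)
    qed
    have sub: "S j \<subseteq> X \<inter> mcball v (r + real n * m)" if "j < n" for j
    proof -
      have "real (Suc j) * m \<le> real n * m"
        using that \<open>0 \<le> m\<close> by (intro mult_right_mono) auto
      then show ?thesis
        using X v by (auto simp: S_def algebra_simps)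
    qed
    have "n * card (Z \<inter> mcball v r) = (\<Sum>j<n. card (Z \<inter> mcball v r))"
      by simp
    also have "\<dots> \<le> (\<Sum>j<n. card (S j))"
      using le by (intro sum_mono) auto
    also have "\<dots> = card (\<Union>j<n. S j)"
    proof (subst card_UN_disjoint)
      show "\<forall>i\<in>{..<n}. \<forall>j\<in>{..<n}. i \<noteq> j \<longrightarrow> S i \<inter> S j = {}"
        using disj by (metis Int_commute linorder_neqE_nat)
    qed (use fin in auto)
    also have "\<dots> \<le> card (X \<inter> mcball v (r + real n * m))"
      using sub \<open>finite X\<close> by (intro card_mono) auto
    finally show ?thesis .
  qed
  with Z show ?thesis
    using that unfolding P_def by blast
qed

text \<open>Each passage to a thin separator uses up one colour, shrinks the radius by
  \<open>real n * m\<close> and divides the bound on the number of points by \<open>n\<close>, while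
  \<open>D\<close> stays the same throughout.\<close>

lemma exists_good_colouring_finite:
  assumes "finite X" "X \<subseteq> M" "0 \<le> m" "2 * (real j * real n * m) \<le> D"
    and "\<And>v. v \<in> M \<Longrightarrow> card (X \<inter> mcball v (real j * real n * m)) < n ^ j"
  shows "\<exists>c. good_colouring m D j X c"
  using assms
proof (induction j arbitrary: X)
  case 0
  \<comment> \<open>Here the hypothesis says that closed balls of radius 0 contain fewer than
    \<open>n ^ 0 = 1\<close> points of \<open>X\<close>.\<close>
  have "X = {}"
  proof (rule ccontr)
    assume "X \<noteq> {}"
    then obtain v where "v \<in> X" by blast
    then have "v \<in> X \<inter> mcball v 0"
      using 0 by auto
    then show False
      using 0 by (force simp: card_eq_0_iff)
  qed
  then show ?case
    unfolding good_colouring_def components_bounded_def using link_trancl_in by fastforce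
next
  case (Suc j)
  define r where "r = real j * real n * m"
  have R: "real (Suc j) * real n * m = r + real n * m"
    by (simp add: r_def algebra_simps)
  obtain Z where Z: "Z \<subseteq> X" "components_bounded m D (X - Z)"
    "\<And>v. v \<in> M \<Longrightarrow> n * card (Z \<inter> mcball v r) \<le> card (X \<inter> mcball v (r + real n * m))"
    using exists_thin_separator[of X m r n D] Suc.prems R by metis
  have "\<exists>c. good_colouring m D j Z c"
  proof (rule Suc.IH)
    have "0 \<le> real n * m"
      using Suc.prems by simp
    then show "2 * (real j * real n * m) \<le> D"
      using Suc.prems(4) R by (simp add: r_def)
    show "card (Z \<inter> mcball v (real j * real n * m)) < n ^ j" if "v \<in> M" for v
    proof -
      have "n * card (Z \<inter> mcball v r) < n * n ^ j"
        using Z(3)[OF that] Suc.prems(5)[OF that] unfolding R power_Suc by (rule le_less_trans)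
      then show ?thesis
        unfolding r_def by (metis mult_less_cancel1)
    qed
  qed (use Suc.prems Z finite_subset in auto)
  then obtain c where c: "good_colouring m D j Z c" ..
  \<comment> \<open>The complement of the separator gets the new colour \<open>j\<close>; the
    colours below \<open>j\<close> occur only on \<open>Z\<close>.\<close>
  define c' where "c' x = (if x \<in> Z then c x else j)" for x
  have cZ: "c x < j" if "x \<in> Z" for x
    using c that by (auto simp: good_colouring_def)
  have "components_bounded m D {x\<in>X. c' x = i}" for i
  proof (cases "i = j")
    case True
    then have "{x\<in>X. c' x = i} \<subseteq> X - Z"
      using cZ by (auto simp: c'_def)
    then show ?thesis
      using Z components_bounded_subset by blast
  next
    case False
    then have "{x\<in>X. c' x = i} \<subseteq> {x\<in>Z. c x = i}"
      by (auto simp: c'_def)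
    then show ?thesis
      using c components_bounded_subset unfolding good_colouring_def by blast
  qed
  moreover have "c' ` X \<subseteq> {..<Suc j}"
    using cZ by (auto simp: c'_def less_Suc_eq)
  ultimately show ?case
    unfolding good_colouring_def by blast
qed

section \<open>From finite sets to the whole net\<close>

text \<open>Colourings of an exhaustion by finite sets have a subsequence that stabilises at every
  point. A chain has finitely many points, so a monochromatic chain for the limit is already one at
  some finite stage, where the uniform bound \<open>D\<close> applies.\<close>

lemma good_colouring_compactness:
  assumes N: "countable N"
    and fin: "\<And>X. finite X \<Longrightarrow> X \<subseteq> N \<Longrightarrow> \<exists>c. good_colouring m D n X c"
  shows "\<exists>c. good_colouring m D n N c"
proof (cases "N = {}")
  case True
  then show ?thesis using fin[of "{}"] by simp
next
  case False
  define X where "X k = from_nat_into N ` {..<k}" for k :: nat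
  have X: "finite (X k)" "X k \<subseteq> N" for k
    using from_nat_into[OF False] by (auto simp: X_def)
  have in_X: "\<forall>\<^sub>F k in sequentially. x \<in> X k" if "x \<in> N" for x
  proof -
    obtain i where "x = from_nat_into N i"
      using from_nat_into_surj[OF N \<open>x \<in> N\<close>] by metis
    then show ?thesis
      unfolding X_def by (auto intro: eventually_mono[OF eventually_gt_at_top[of i]])
  qed
  obtain C where C: "\<And>k. good_colouring m D n (X k) (C k)"
    using fin[OF X] by metis
  \<comment> \<open>The value 0 off \<open>X k\<close> keeps the functions uniformly bounded on all
    of \<open>N\<close>, as the diagonal argument requires.\<close>
  define C' where "C' k x = (if x \<in> X k then C k x else 0)" for k x
  have "norm (real (C' k x)) \<le> real n" for k x
    using C[of k] by (force simp: C'_def good_colouring_def)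
  then obtain \<sigma> :: "nat \<Rightarrow> nat" where \<sigma>: "strict_mono \<sigma>"
    and lim: "\<And>x. x \<in> N \<Longrightarrow> \<exists>l. (\<lambda>k. real (C' (\<sigma> k) x)) \<longlonglongrightarrow> l"
    using function_convergent_subsequence[OF N, of "\<lambda>k x. real (C' k x)" "real n"] by metis
  have "\<exists>a. \<forall>\<^sub>F k in sequentially. x \<in> X (\<sigma> k) \<and> C (\<sigma> k) x = a" if x: "x \<in> N" for x
  proof -
    obtain l where l: "(\<lambda>k. real (C' (\<sigma> k) x)) \<longlonglongrightarrow> l"
      using lim[OF x] by blast
    \<comment> \<open>The naturals are closed in the reals, so the limit is a colour; natural values
      at distance less than 1 from it are equal to it.\<close>
    then have "l \<in> real ` UNIV"
      by (rule closed_sequentially[OF closed_of_nat_image, rotated]) simp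
    then obtain a where "l = real a" by blast
    then have "\<forall>\<^sub>F k in sequentially. dist (real (C' (\<sigma> k) x)) (real a) < 1"
      using l by (auto simp: tendsto_iff)
    moreover have "\<forall>\<^sub>F k in sequentially. x \<in> X (\<sigma> k)"
      using in_X[OF x] filterlim_subseq[OF \<sigma>] by (rule eventually_compose_filterlim)
    ultimately have "\<forall>\<^sub>F k in sequentially. x \<in> X (\<sigma> k) \<and> C (\<sigma> k) x = a"
      by eventually_elim (auto simp: C'_def dist_real_def)
    then show ?thesis by blast
  qed
  then obtain c where c: "\<And>x. x \<in> N \<Longrightarrow> \<forall>\<^sub>F k in sequentially. x \<in> X (\<sigma> k) \<and> C (\<sigma> k) x = c x"
    by metis
  have "c x < n" if x: "x \<in> N" for x
  proof -
    obtain k where "x \<in> X (\<sigma> k)" "C (\<sigma> k) x = c x"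
      using eventually_happens'[OF sequentially_bot c[OF x]] by blast
    then show ?thesis
      using C[of "\<sigma> k"] by (auto simp: good_colouring_def)
  qed
  moreover have "d x y \<le> D" if xy: "(x, y) \<in> (link m {x\<in>N. c x = i})\<^sup>+" for x y i
  proof -
    have link: "\<forall>\<^sub>F k in sequentially. (u, w) \<in> link m {x\<in>X (\<sigma> k). C (\<sigma> k) x = i}"
      if "(u, w) \<in> link m {x\<in>N. c x = i}" for u w
    proof -
      have uw: "u \<in> N" "w \<in> N" "c u = i" "c w = i" "d u w \<le> m"
        using that by (auto simp: link_def)
      show ?thesis
        using c[OF uw(1)] c[OF uw(2)] by eventually_elim (auto simp: link_def uw)
    qed
    have "\<forall>\<^sub>F k in sequentially. (x, y) \<in> (link m {x\<in>X (\<sigma> k). C (\<sigma> k) x = i})\<^sup>+"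
      using xy
    proof (induction rule: trancl_induct)
      case (base y)
      from link[OF this] show ?case by eventually_elim auto
    next
      case (step y z)
      from link[OF step.hyps(2)] step.IH show ?case
        by eventually_elim (auto intro: trancl_into_trancl)
    qed
    from eventually_happens[OF this] show ?thesis
      using C by (fastforce simp: good_colouring_def components_bounded_def)
  qed
  ultimately show ?thesis
    unfolding good_colouring_def components_bounded_def by (intro exI[of _ c]) auto
qed

section \<open>From a coloured net to a covering of the space\<close>

text \<open>Moving both endpoints by at most 1 changes their distance by at most 2. So
  \<open>p\<close> maps \<open>m\<close>-chains to \<open>(m + 2)\<close>-chains, and the diameter
  bound also loses only 2.\<close>

lemma good_colouring_pullback:
  assumes p: "\<And>x. x \<in> M \<Longrightarrow> p x \<in> N \<and> d x (p x) \<le> 1" and N: "N \<subseteq> M"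
    and c: "good_colouring (m + 2) D n N c"
  shows "good_colouring m (D + 2) n M (c \<circ> p)"
proof -
  have pM: "p x \<in> M" if "x \<in> M" for x
    using p that N by blast
  have "d x y \<le> D + 2" if xy: "(x, y) \<in> (link m {x\<in>M. (c \<circ> p) x = i})\<^sup>+" for x y i
  proof -
    have link: "(p u, p w) \<in> link (m + 2) {x\<in>N. c x = i}"
      if "(u, w) \<in> link m {x\<in>M. (c \<circ> p) x = i}" for u w
    proof -
      have uw: "u \<in> M" "w \<in> M" "c (p u) = i" "c (p w) = i" "d u w \<le> m"
        using that by (auto simp: link_def)
      then have "d (p u) (p w) \<le> d (p u) u + d u w + d w (p w)"
        using triangle[of "p u" u "p w"] triangle[of u w "p w"] pM by force
      then show ?thesis
        using uw p[of u] p[of w] commute[of u "p u"] by (auto simp: link_def)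
    qed
    have "(p x, p y) \<in> (link (m + 2) {x\<in>N. c x = i})\<^sup>+"
      using xy
    proof (induction rule: trancl_induct)
      case (base y)
      then show ?case using link by blast
    next
      case (step y z)
      then show ?case using link by (meson trancl_into_trancl)
    qed
    then have "d (p x) (p y) \<le> D"
      using c by (force simp: good_colouring_def components_bounded_def)
    moreover have M: "x \<in> M" "y \<in> M"
      using link_trancl_in[OF xy] by auto
    then have "d x y \<le> d x (p x) + d (p x) (p y) + d (p y) y"
      using triangle[of x "p x" y] triangle[of "p x" "p y" y] pM by force
    ultimately show ?thesis
      using p[of x] p[of y] M commute[of y "p y"] by auto
  qed
  moreover have "(c \<circ> p) ` M \<subseteq> {..<n}"
    using c p by (force simp: good_colouring_def)
  ultimately show ?thesis
    unfolding good_colouring_def components_bounded_def by blast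
qed

text \<open>The covering consists of the \<open>2 * m\<close>-chain components of the colour
  classes. Two points of a ball of radius \<open>m\<close> are within \<open>2 * m\<close>, so the
  ball meets at most one component of each colour.\<close>

lemma asdim_le_of_good_colouring:
  assumes "\<And>m. 0 < m \<Longrightarrow> \<exists>D c. good_colouring m D (n + 1) M c"
  shows "asdim_le n"
  unfolding asdim_le_def
proof (intro allI impI)
  fix m :: real
  assume "0 < m"
  then obtain D c where c: "good_colouring (2 * m) D (n + 1) M c"
    using assms[of "2 * m"] by auto
  define R where "R q = (link (2 * m) {x\<in>M. c x = c q})\<^sup>+" for q
  define U where "U q = {x. (q, x) \<in> R q}" for q
  have U_sub: "U q \<subseteq> {x\<in>M. c x = c q}" for q
    using link_trancl_in unfolding U_def R_def by blast
  have self: "q \<in> U q" if "q \<in> M" for q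
    using that \<open>0 < m\<close> by (auto simp: U_def R_def link_def intro!: r_into_trancl)
  have symR: "sym (R q)" for q
    unfolding R_def by (intro sym_trancl sym_link)
  have transR: "trans (R q)" for q
    unfolding R_def by (rule trans_trancl)
  \<comment> \<open>The maximum with 1 supplies the positive bound demanded by
    \<open>asdim_le\<close>, whatever the sign of \<open>D\<close>.\<close>
  have diam: "d x y \<le> max D 1" if "x \<in> U q" "y \<in> U q" for x y q
  proof -
    have "(x, y) \<in> R q"
      using that symD[OF symR] transD[OF transR] unfolding U_def by blast
    then show ?thesis
      using c by (force simp: R_def good_colouring_def components_bounded_def)
  qed
  have same: "U q = U q'"
    if "c q = c q'" "x \<in> U q" "x' \<in> U q'" "x \<in> mball v m" "x' \<in> mball v m" for q q' x x' v
  proof -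
    have R: "R q' = R q"
      using that by (simp add: R_def)
    have "d x x' \<le> 2 * m"
      using that triangle[of x v x'] commute[of x v] by auto
    then have "(x, x') \<in> R q"
      using that U_sub[of q] U_sub[of q'] unfolding R_def
      by (intro r_into_trancl) (auto simp: link_def)
    moreover have "(q, x) \<in> R q" "(q', x') \<in> R q"
      using that R by (auto simp: U_def)
    ultimately have "(q, q') \<in> R q"
      using symD[OF symR] transD[OF transR] by blast
    then show ?thesis
      unfolding U_def R using symD[OF symR] transD[OF transR] by blast
  qed
  have "ecard {V \<in> U ` M. mball v m \<inter> V \<noteq> {}} \<le> enat (n + 1)" if "v \<in> M" for v
  proof -
    \<comment> \<open>For each colour, \<open>h\<close> picks a point whose component meets the
      ball, if there is one. For other colours the arbitrary value is harmless, since only an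
      inclusion into the image is claimed.\<close>
    define h where "h i = (SOME q. q \<in> M \<and> c q = i \<and> mball v m \<inter> U q \<noteq> {})" for i
    have sub: "{V \<in> U ` M. mball v m \<inter> V \<noteq> {}} \<subseteq> (\<lambda>i. U (h i)) ` {..<n + 1}"
    proof clarify
      fix q
      assume q: "q \<in> M" "mball v m \<inter> U q \<noteq> {}"
      then have hq: "h (c q) \<in> M \<and> c (h (c q)) = c q \<and> mball v m \<inter> U (h (c q)) \<noteq> {}"
        unfolding h_def using someI[of "\<lambda>p. p \<in> M \<and> c p = c q \<and> mball v m \<inter> U p \<noteq> {}" q] by blast
      from hq obtain x x' where "x \<in> U (h (c q))" "x \<in> mball v m" "x' \<in> U q" "x' \<in> mball v m"
        using q by blast
      then have "U q = U (h (c q))"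
        using hq same[of q "h (c q)" x' x v] by simp
      moreover have "c q < n + 1"
        using c q by (auto simp: good_colouring_def)
      ultimately show "U q \<in> (\<lambda>i. U (h i)) ` {..<n + 1}"
        by blast
    qed
    then have "finite {V \<in> U ` M. mball v m \<inter> V \<noteq> {}}"
      by (rule finite_subset) simp
    moreover have "card {V \<in> U ` M. mball v m \<inter> V \<noteq> {}} \<le> n + 1"
      using surj_card_le[OF _ sub] by simp
    ultimately show ?thesis
      by (simp add: ecard_def)
  qed
  then show "\<exists>D>0. \<exists>\<U>. (\<forall>U\<in>\<U>. U \<subseteq> M) \<and> \<Union>\<U> = M
        \<and> (\<forall>U\<in>\<U>. \<forall>x\<in>U. \<forall>y\<in>U. d x y \<le> D)
        \<and> (\<forall>v\<in>M. ecard {U\<in>\<U>. mball v m \<inter> U \<noteq> {}} \<le> enat (n + 1))"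
    using U_sub self diam by (intro exI[of _ "max D 1"] exI[of _ "U ` M"] conjI) (auto | blast)+
qed

section \<open>Nets and the growth hypothesis\<close>

text \<open>A maximal \<open>t\<close>-separated set, given by Zorn's lemma, is a net: a point at
  distance more than \<open>t\<close> from all of it could be added.\<close>

lemma exists_net:
  assumes "0 < t"
  shows "\<exists>N. net t N"
proof -
  define A where "A = {N. N \<subseteq> M \<and> (\<forall>p\<in>N. \<forall>q\<in>N. p \<noteq> q \<longrightarrow> t \<le> d p q)}"
  have "\<exists>N\<in>A. \<forall>X\<in>A. N \<subseteq> X \<longrightarrow> X = N"
  proof (rule subset_Zorn')
    fix C
    assume C: "subset.chain A C"
    have "t \<le> d p q" if "p \<in> \<Union>C" "q \<in> \<Union>C" "p \<noteq> q" for p q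
    proof -
      obtain P Q where PQ: "P \<in> C" "Q \<in> C" "p \<in> P" "q \<in> Q"
        using \<open>p \<in> \<Union>C\<close> \<open>q \<in> \<Union>C\<close> by blast
      moreover have "P \<subseteq> Q \<or> Q \<subseteq> P"
        using C PQ unfolding subset_chain_def by blast
      ultimately have "\<exists>P\<in>C. p \<in> P \<and> q \<in> P"
        by blast
      then show ?thesis
        using C \<open>p \<noteq> q\<close> unfolding A_def subset_chain_def by blast
    qed
    then show "\<Union>C \<in> A"
      using C unfolding A_def subset_chain_def by blast
  qed
  then obtain N where N: "N \<in> A" and max: "\<And>X. X \<in> A \<Longrightarrow> N \<subseteq> X \<Longrightarrow> X = N"
    by blast
  have "\<exists>p\<in>N. d x p \<le> t" if "x \<in> M" for x
  proof (rule ccontr)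
    assume far: "\<not> (\<exists>p\<in>N. d x p \<le> t)"
    then have "t \<le> d x p" "t \<le> d p x" if "p \<in> N" for p
      using that commute[of x p] by force+
    then have "insert x N \<in> A"
      using N \<open>x \<in> M\<close> unfolding A_def by auto
    then have "x \<in> N"
      using max[of "insert x N"] by blast
    moreover have "d x x \<le> t"
      using that assms by simp
    ultimately show False
      using far by blast
  qed
  then have "net t N"
    using N unfolding net_def A_def by simp
  then show ?thesis ..
qed

end

theorem lemma3p2:
  fixes M :: "'a set" and d :: "'a \<Rightarrow> 'a \<Rightarrow> real" and k :: nat
  assumes "Metric_space M d"
    and "((\<lambda>r::real. ereal_of_enat (Metric_space.growth M d 1 r) / ereal (r ^ (k + 1)))
           \<longlongrightarrow> 0) at_top"
  shows "Metric_space.asdim M d \<le> enat k"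
proof -
  interpret Metric_space M d by fact
  obtain N where net: "net 1 N"
    using exists_net[of 1] by auto
  then have N: "N \<subseteq> M"
    by (simp add: net_def)
  have le_growth: "ecard (mball v r \<inter> N) \<le> growth 1 r" if "v \<in> M" for v r
    unfolding growth_def using that net by (intro Sup_upper) blast
  \<comment> \<open>Once \<open>r\<close> is positive, an infinite growth value would make the
    quotient infinite, so the limit also yields finiteness.\<close>
  have small: "\<forall>\<^sub>F r in at_top. growth 1 r \<noteq> \<infinity> \<and> real (the_enat (growth 1 r)) < e * r ^ (k + 1)"
    if "0 < e" for e :: real
  proof -
    have "\<forall>\<^sub>F r in at_top. ereal_of_enat (growth 1 r) / ereal (r ^ (k + 1)) < ereal e"
      using assms(2) that by (intro order_tendstoD) auto
    with eventually_gt_at_top[of 0] show ?thesis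
    proof eventually_elim
      case (elim r)
      show ?case
      proof (cases "growth 1 r")
        case (enat g)
        with elim show ?thesis
          by (simp add: divide_less_eq)
      next
        case infinity
        with elim show ?thesis
          by simp
      qed
    qed
  qed
  \<comment> \<open>Growth is finite at all large radii, and every ball lies in a concentric one of
    such a radius.\<close>
  have fin: "finite (mball v r \<inter> N)" if "v \<in> M" for v r
  proof -
    have "\<forall>\<^sub>F s in at_top. r \<le> s \<and> growth 1 s \<noteq> \<infinity>"
      using eventually_ge_at_top[of r] small[OF zero_less_one] by eventually_elim auto
    then obtain s where s: "r \<le> s" "growth 1 s \<noteq> \<infinity>"
      using eventually_happens by force
    then have "finite (mball v s \<inter> N)"
      using le_growth[OF that, of s] by (auto simp: ecard_def split: if_splits)
    moreover have "mball v r \<inter> N \<subseteq> mball v s \<inter> N"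
      using s by auto
    ultimately show ?thesis
      by (rule rev_finite_subset)
  qed
  have "countable N"
  proof (cases "N = {}")
    case False
    then obtain v where v: "v \<in> N" by blast
    have "N \<subseteq> (\<Union>i::nat. mball v (real i) \<inter> N)"
      using N v reals_Archimedean2 by fastforce
    moreover have "countable (\<Union>i::nat. mball v (real i) \<inter> N)"
      using fin v N by (intro countable_UN) (auto intro: countable_finite)
    ultimately show ?thesis
      by (rule countable_subset)
  qed simp
  obtain p where p: "\<And>x. x \<in> M \<Longrightarrow> p x \<in> N \<and> d x (p x) \<le> 1"
    using net unfolding net_def by metis
  have colour_N: "\<exists>D c. good_colouring m D (k + 1) N c" if "0 < m" for m
  proof -
    \<comment> \<open>With \<open>k + 1\<close> colours the colouring of finite sets looks at balls
      of radius \<open>a * real n\<close>.\<close>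
    define a where "a = real (k + 1) * m"
    have "0 < a"
      using that by (simp add: a_def)
    \<comment> \<open>Chosen so that \<open>e * ((a + 1) * real n) ^ (k + 1)\<close> is exactly
      \<open>n ^ (k + 1)\<close>.\<close>
    define e where "e = 1 / (a + 1) ^ (k + 1)"
    have "0 < e"
      using \<open>0 < a\<close> by (simp add: e_def)
    \<comment> \<open>The extra 1 puts the closed balls of the colouring argument inside the open
      balls counted by \<open>growth\<close>; for \<open>n\<close> \<ge> 1 it is absorbed by passing
      from \<open>a\<close> to \<open>a + 1\<close>.\<close>
    have "filterlim (\<lambda>n. a * real n + 1) at_top sequentially"
      using \<open>0 < a\<close> by real_asymp
    from eventually_compose_filterlim[OF small[OF \<open>0 < e\<close>] this]
    have "\<forall>\<^sub>F n in sequentially. 1 \<le> n \<and> growth 1 (a * real n + 1) \<noteq> \<infinity> \<and>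
        real (the_enat (growth 1 (a * real n + 1))) < e * (a * real n + 1) ^ (k + 1)"
      using eventually_ge_at_top[of 1] by eventually_elim auto
    then obtain n where "1 \<le> n" and g_fin: "growth 1 (a * real n + 1) \<noteq> \<infinity>"
      and g: "real (the_enat (growth 1 (a * real n + 1))) < e * (a * real n + 1) ^ (k + 1)"
      using eventually_happens by force
    note g
    also have "e * (a * real n + 1) ^ (k + 1) \<le> e * ((a + 1) * real n) ^ (k + 1)"
      using \<open>0 < a\<close> \<open>0 < e\<close> \<open>1 \<le> n\<close>
      by (intro mult_left_mono power_mono) (auto simp: algebra_simps)
    also have "\<dots> = real (n ^ (k + 1))"
      using \<open>0 < a\<close> unfolding e_def power_mult_distrib by simp
    finally have g_less: "growth 1 (a * real n + 1) < enat (n ^ (k + 1))"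
      using g_fin by (cases "growth 1 (a * real n + 1)") (simp_all del: of_nat_power of_nat_mult)
    have R: "real (k + 1) * real n * m = a * real n"
      by (simp add: a_def)
    have "\<exists>c. good_colouring m (2 * (a * real n)) (k + 1) N c"
    proof (rule good_colouring_compactness[OF \<open>countable N\<close>])
      fix X
      assume X: "finite X" "X \<subseteq> N"
      show "\<exists>c. good_colouring m (2 * (a * real n)) (k + 1) X c"
      proof (rule exists_good_colouring_finite[where n = n])
        fix v
        assume v: "v \<in> M"
        have "card (X \<inter> mcball v (a * real n)) \<le> card (mball v (a * real n + 1) \<inter> N)"
          using X fin[OF v] by (intro card_mono) auto
        also have "enat \<dots> \<le> growth 1 (a * real n + 1)"
          using le_growth[OF v, of "a * real n + 1"] fin[OF v] by (simp add: ecard_def)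
        also note g_less
        finally show "card (X \<inter> mcball v (real (k + 1) * real n * m)) < n ^ (k + 1)"
          unfolding R by simp
      qed (use X N that R in auto)
    qed
    then show ?thesis by blast
  qed
  have "asdim_le k"
  proof (rule asdim_le_of_good_colouring)
    fix m :: real
    assume "0 < m"
    then obtain D c where "good_colouring (m + 2) D (k + 1) N c"
      using colour_N[of "m + 2"] by auto
    from good_colouring_pullback[OF p N this]
    show "\<exists>D c. good_colouring m D (k + 1) M c" by blast
  qed
  then show ?thesis
    by (simp add: asdim_le_iff)
qed

end
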